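(* Let $A_1,\ldots,A_n$ be finite sets of points in $\mathbb{R}^d$ and let $x\in\mathbb{R}^d$. If $x\in\mathrm{conv}(A_i)$ for all $i\in[n]$ and $n\ge d+2$, then $\mathbf{RG}_{\mathrm{CC}}((A_1,\ldots,A_n),x)$ is connected.
   Context: $\mathbf{RG}_{\mathrm{CC}}((A_1,\ldots,A_n),x)$ is the graph whose vertices are the ordered tuples $(a_1,\ldots,a_n)$ with $a_i\in A_i$ for all $i$ and $x\in\mathrm{conv}(\{a_1,\ldots,a_n\})$; two tuples $(a_1,\ldots,a_n)$ and $(b_1,\ldots,b_n)$ are adjacent if there is a unique index $j$ with $a_j\neq b_j$ and moreover $x\in\mathrm{conv}(\{a_i:i\neq j\})$. *)

theory Defs
  imports "HOL-Analysis.Analysis"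
begin

text \<open>Tuples (a_1,...,a_n) are represented as functions on the index set {0..<n},
  extensional (equal to undefined outside {0..<n}).\<close>

definition rg_cc_vertices :: "nat \<Rightarrow> (nat \<Rightarrow> 'a::euclidean_space set) \<Rightarrow> 'a \<Rightarrow> (nat \<Rightarrow> 'a) set" where
  "rg_cc_vertices n A x =
     {a. a \<in> (\<Pi>\<^sub>E i\<in>{..<n}. A i) \<and> x \<in> convex hull (a ` {..<n})}"

definition rg_cc_adj :: "nat \<Rightarrow> (nat \<Rightarrow> 'a::euclidean_space set) \<Rightarrow> 'a \<Rightarrow> (nat \<Rightarrow> 'a) \<Rightarrow> (nat \<Rightarrow> 'a) \<Rightarrow> bool" where
  "rg_cc_adj n A x a b \<longleftrightarrow>
     a \<in> rg_cc_vertices n A x \<and> b \<in> rg_cc_vertices n A x \<and>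
     (\<exists>!j. j < n \<and> a j \<noteq> b j) \<and>
     (\<forall>j<n. a j \<noteq> b j \<longrightarrow> x \<in> convex hull (a ` ({..<n} - {j})))"

definition rg_cc_connected :: "nat \<Rightarrow> (nat \<Rightarrow> 'a::euclidean_space set) \<Rightarrow> 'a \<Rightarrow> bool" where
  "rg_cc_connected n A x \<longleftrightarrow>
     (\<forall>a\<in>rg_cc_vertices n A x. \<forall>b\<in>rg_cc_vertices n A x. (rg_cc_adj n A x)\<^sup>*\<^sup>* a b)"

end

theory Submission
  imports Defs
begin

text \<open>
  The proof is a mountain pass argument. Join two vertices by an arbitrary walk among all colourful
  tuples, changing one coordinate \<open>j\<close> at a time, and measure a step by the distance from \<open>x\<close> to
  the convex hull of the \<open>n - 1\<close> unchanged points. Choose a walk whose largest step \<open>r\<close> is minimal;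
  \<open>r = 0\<close> is what is wanted. Suppose \<open>r > 0\<close>, let \<open>p\<close> be the point nearest to \<open>x\<close> at a critical
  tuple \<open>t\<close>, and let \<open>w = p - x\<close>. Each colour class has a point \<open>c\<close> with \<open>w \<bullet> c < w \<bullet> p\<close>, and
  inserting it at a coordinate \<open>j\<close> that is not needed to represent \<open>p\<close> brings the hull closer to
  \<open>x\<close>. Two dispensable coordinates \<open>j\<close>, \<open>m\<close> that can be dropped simultaneously give consecutive
  tuples joined by steps shorter than \<open>r\<close>. So the walk can be rerouted around \<open>t\<close> once the
  dispensable coordinates are connected under simultaneous dispensability; they label the
  faces of the polytope of convex weights representing \<open>p\<close>. Either some weight vanishes identically,
  and that coordinate is linked to all others, or all \<open>n \<ge> d + 2\<close> points lie in the supporting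
  hyperplane at \<open>p\<close>, so the polytope has dimension at least 2 and a connected boundary.
\<close>

section \<open>Convex weights and linear relations of indexed families\<close>

text \<open>Weights belong to indices, not to points, so that a point chosen in two colours keeps
  two separate weights.\<close>

lemma convex_hull_image_iff:
  fixes t :: "'i \<Rightarrow> 'a::real_vector"
  assumes "finite J"
  shows "p \<in> convex hull (t ` J) \<longleftrightarrow>
    (\<exists>c. (\<forall>i\<in>J. 0 \<le> c i) \<and> sum c J = 1 \<and> (\<Sum>i\<in>J. c i *\<^sub>R t i) = p)" (is "_ \<longleftrightarrow> ?R p")
proof
  assume "p \<in> convex hull (t ` J)"
  moreover have "convex hull (t ` J) \<subseteq> {p. ?R p}"
  proof (rule hull_minimal)
    show "t ` J \<subseteq> {p. ?R p}"
    proof clarify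
      fix j assume "j \<in> J"
      then show "?R (t j)"
        using assms
        by (intro exI[of _ "\<lambda>i. if i = j then 1 else 0"])
           (simp add: if_distrib[of "\<lambda>c. c *\<^sub>R _"] cong: if_cong)
    qed
    show "convex {p. ?R p}"
    proof (rule convexI, clarify)
      fix c d :: "'i \<Rightarrow> real" and u v :: real
      assume *: "0 \<le> u" "0 \<le> v" "u + v = 1" "\<forall>i\<in>J. 0 \<le> c i" "sum c J = 1" "\<forall>i\<in>J. 0 \<le> d i" "sum d J = 1"
      show "?R (u *\<^sub>R (\<Sum>i\<in>J. c i *\<^sub>R t i) + v *\<^sub>R (\<Sum>i\<in>J. d i *\<^sub>R t i))"
        using * by (intro exI[of _ "\<lambda>i. u * c i + v * d i"])
          (simp add: sum.distrib scaleR_add_left scaleR_sum_right flip: sum_distrib_left)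
    qed
  qed
  ultimately show "?R p" by blast
next
  assume "?R p"
  then obtain c where c: "\<forall>i\<in>J. 0 \<le> c i" "sum c J = 1" "(\<Sum>i\<in>J. c i *\<^sub>R t i) = p" by blast
  have "(\<Sum>i\<in>J. c i *\<^sub>R t i) \<in> convex hull (t ` J)"
    by (rule convex_sum) (use assms c in \<open>auto intro: hull_inc\<close>)
  with c(3) show "p \<in> convex hull (t ` J)" by simp
qed

lemma family_linear_relation:
  fixes t :: "'i \<Rightarrow> 'a::euclidean_space"
  assumes "finite I" "card I > DIM('a)"
  obtains c where "(\<Sum>i\<in>I. c i *\<^sub>R t i) = 0" "\<exists>i\<in>I. c i \<noteq> 0"
proof (cases "inj_on t I")
  case True
  then have "dependent (t ` I)"
    using assms by (intro dependent_biggerset) (simp add: card_image)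
  then obtain u v where u: "(\<Sum>v\<in>t ` I. u v *\<^sub>R v) = 0" "v \<in> t ` I" "u v \<noteq> 0"
    using assms by (auto simp: dependent_finite)
  show thesis
    by (rule that[of "u \<circ> t"]) (use u True in \<open>auto simp: sum.reindex\<close>)
next
  case False
  then obtain i j where ij: "i \<in> I" "j \<in> I" "t i = t j" "i \<noteq> j"
    by (auto simp: inj_on_def)
  let ?c = "\<lambda>k. (if k = i then 1 else 0) - (if k = j then 1 else (0::real))"
  have "(\<Sum>k\<in>I. ?c k *\<^sub>R t k) = 0"
    using ij assms(1)
    by (simp add: scaleR_diff_left sum_subtractf if_distrib[of "\<lambda>c. c *\<^sub>R _"] cong: if_cong)
  then show thesis
    by (rule that) (use ij in auto)
qed

text \<open>Translated to level 1 of \<open>w\<close>, the points satisfy a linear relation; pairing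
  it with \<open>w\<close> shows that its coefficients sum to 0, so it survives translating back.
  Lying in a hyperplane saves one point over the general affine bound.\<close>

lemma hyperplane_affine_relation:
  fixes t :: "'i \<Rightarrow> 'a::euclidean_space"
  assumes "finite I" "card I > DIM('a)" "w \<noteq> 0" "\<And>i. i \<in> I \<Longrightarrow> w \<bullet> t i = b"
  obtains c where "(\<Sum>i\<in>I. c i *\<^sub>R t i) = 0" "sum c I = 0" "\<exists>i\<in>I. c i < 0"
proof -
  define z where "z = ((b - 1) / (w \<bullet> w)) *\<^sub>R w"
  have wz: "w \<bullet> (t i - z) = 1" if "i \<in> I" for i
    using assms(3,4) that by (simp add: z_def inner_diff_right)
  obtain c where c: "(\<Sum>i\<in>I. c i *\<^sub>R (t i - z)) = 0" "\<exists>i\<in>I. c i \<noteq> 0"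
    using family_linear_relation[OF assms(1,2)] by metis
  have "0 = w \<bullet> (\<Sum>i\<in>I. c i *\<^sub>R (t i - z))"
    using c by simp
  also have "\<dots> = sum c I"
    unfolding inner_sum_right inner_scaleR_right using wz by simp
  finally have s: "sum c I = 0" by simp
  then have "(\<Sum>i\<in>I. c i *\<^sub>R t i) = 0"
    using c(1) by (simp add: scaleR_diff_right sum_subtractf flip: scaleR_sum_left)
  moreover have "\<exists>i\<in>I. c i < 0"
  proof (rule ccontr)
    assume "\<not> ?thesis"
    then have "\<forall>i\<in>I. c i = 0"
      using s assms(1) by (subst (asm) sum_nonneg_eq_0_iff) auto
    with c(2) show False by blast
  qed
  ultimately show thesis using s that by blast
qed

section \<open>Vanishing weights and pivoting\<close>

lemma convex_hull_drop_zeros: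
  fixes t :: "'i \<Rightarrow> 'a::real_vector"
  assumes "finite I" "\<And>i. i \<in> I \<Longrightarrow> 0 \<le> c i" "sum c I = 1" "(\<Sum>i\<in>I. c i *\<^sub>R t i) = p"
    and "\<And>i. i \<in> Z \<Longrightarrow> c i = 0"
  shows "p \<in> convex hull (t ` (I - Z))"
proof -
  have "sum c (I - Z) = sum c I" "(\<Sum>i\<in>I - Z. c i *\<^sub>R t i) = (\<Sum>i\<in>I. c i *\<^sub>R t i)"
    using assms(1,5) by (auto intro!: sum.mono_neutral_left)
  moreover have "finite (I - Z)" using assms(1) by simp
  ultimately show ?thesis
    using assms(2-4) unfolding convex_hull_image_iff[OF \<open>finite (I - Z)\<close>]
    by (intro exI[of _ c]) simp
qed

lemma convex_hull_remove_weights: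
  fixes t :: "'i \<Rightarrow> 'a::real_vector"
  assumes "finite I" "p \<in> convex hull (t ` (I - Z))" "Z \<subseteq> I"
  obtains c where "\<And>i. i \<in> I \<Longrightarrow> 0 \<le> c i" "sum c I = 1" "(\<Sum>i\<in>I. c i *\<^sub>R t i) = p"
    "\<And>i. i \<in> Z \<Longrightarrow> c i = 0"
proof -
  obtain c where c: "\<forall>i\<in>I - Z. 0 \<le> c i" "sum c (I - Z) = 1" "(\<Sum>i\<in>I - Z. c i *\<^sub>R t i) = p"
    using assms convex_hull_image_iff[of "I - Z" p t] by auto
  let ?c = "\<lambda>i. if i \<in> Z then 0 else c i"
  have "sum ?c I = sum c (I - Z)" "(\<Sum>i\<in>I. ?c i *\<^sub>R t i) = (\<Sum>i\<in>I - Z. c i *\<^sub>R t i)"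
    using assms by (auto intro!: sum.mono_neutral_cong_right)
  then show thesis
    using c by (intro that[of ?c]) auto
qed

text \<open>The pivot step of the simplex method: moving the weights along \<open>v\<close>
  preserves their sum and the represented point, and the minimal ratio is the largest step keeping
  them nonnegative. \<open>Z\<close> may collect several coordinates that reach 0 together.\<close>

lemma ratio_pivot:
  fixes t :: "'i \<Rightarrow> 'a::real_vector"
  assumes "finite I" "\<And>i. i \<in> I \<Longrightarrow> 0 \<le> c i" "sum c I = 1" "(\<Sum>i\<in>I. c i *\<^sub>R t i) = p"
    and "(\<Sum>i\<in>I. v i *\<^sub>R t i) = 0" "sum v I = 0"
    and "i \<in> I" "v i < 0" "\<And>l. l \<in> I \<Longrightarrow> v l < 0 \<Longrightarrow> c i / - v i \<le> c l / - v l"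
    and "\<And>m. m \<in> Z \<Longrightarrow> c m + c i / - v i * v m = 0"
  shows "p \<in> convex hull (t ` (I - Z))"
proof (rule convex_hull_drop_zeros[where c = "\<lambda>l. c l + c i / - v i * v l"])
  fix l assume l: "l \<in> I"
  have q: "c i / - v i \<ge> 0"
    using assms(2,7,8) by (simp add: divide_nonneg_neg)
  show "0 \<le> c l + c i / - v i * v l"
  proof (cases "v l < 0")
    case True
    then have "c i / - v i * (- v l) \<le> c l"
      using assms(9)[OF l True] by (subst (asm) pos_le_divide_eq) auto
    then show ?thesis by simp
  next
    case False
    then show ?thesis using q assms(2)[OF l] by (intro add_nonneg_nonneg mult_nonneg_nonneg) auto
  qed
next
  show "(\<Sum>l\<in>I. c l + c i / - v i * v l) = 1"
    unfolding sum.distrib sum_distrib_left[symmetric] using assms(3,6) by simp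
  show "(\<Sum>l\<in>I. (c l + c i / - v i * v l) *\<^sub>R t l) = p"
    unfolding scaleR_add_left sum.distrib scaleR_scaleR[symmetric] scaleR_sum_right[symmetric]
    using assms(4,5) by simp
qed (use assms in auto)

lemma exists_min_ratio:
  fixes c v :: "'i \<Rightarrow> real"
  assumes "finite I" "\<exists>i\<in>I. v i < 0"
  obtains i where "i \<in> I" "v i < 0" "\<And>l. l \<in> I \<Longrightarrow> v l < 0 \<Longrightarrow> c i / - v i \<le> c l / - v l"
proof -
  let ?N = "{i\<in>I. v i < 0}" and ?f = "\<lambda>i. c i / - v i"
  have "finite ?N" "?N \<noteq> {}" using assms by auto
  then obtain i where "is_arg_min ?f (\<lambda>i. i \<in> ?N) i"
    using ex_is_arg_min_if_finite by blast
  then show thesis by (intro that[of i]) (auto simp: is_arg_min_linorder)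
qed

section \<open>Dispensable indices of a supported point\<close>

text \<open>The nonnegative excesses \<open>w \<bullet> t i - w \<bullet> p\<close> have weighted
  average 0.\<close>

lemma positive_weights_in_hyperplane:
  fixes t :: "'i \<Rightarrow> 'a::real_inner"
  assumes "finite I" "\<And>i. i \<in> I \<Longrightarrow> 0 < c i" "sum c I = 1" "(\<Sum>i\<in>I. c i *\<^sub>R t i) = p"
    and "\<And>i. i \<in> I \<Longrightarrow> w \<bullet> p \<le> w \<bullet> t i" "i \<in> I"
  shows "w \<bullet> t i = w \<bullet> p"
proof -
  have "(\<Sum>i\<in>I. c i * (w \<bullet> t i - w \<bullet> p)) = w \<bullet> (\<Sum>i\<in>I. c i *\<^sub>R t i) - sum c I * (w \<bullet> p)"
    by (simp add: right_diff_distrib sum_subtractf inner_sum_right sum_distrib_right)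
  also have "\<dots> = 0" using assms(3,4) by simp
  finally have "(\<Sum>i\<in>I. c i * (w \<bullet> t i - w \<bullet> p)) = 0" .
  then have "\<forall>i\<in>I. c i * (w \<bullet> t i - w \<bullet> p) = 0"
    using assms(1,2,5) by (subst (asm) sum_nonneg_eq_0_iff) (auto simp: less_imp_le)
  with assms(2,6) show ?thesis by fastforce
qed

text \<open>Caratheodory's theorem with one point fewer: if no weight is 0 already, all points lie
  in the supporting hyperplane and a pivot removes one.\<close>

lemma supported_caratheodory:
  fixes t :: "'i \<Rightarrow> 'a::euclidean_space"
  assumes "finite I" "card I > DIM('a)" "w \<noteq> 0" "\<And>i. i \<in> I \<Longrightarrow> w \<bullet> p \<le> w \<bullet> t i"
    and "p \<in> convex hull (t ` I)"
  obtains m where "m \<in> I" "p \<in> convex hull (t ` (I - {m}))"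
proof -
  obtain c where c: "\<And>i. i \<in> I \<Longrightarrow> 0 \<le> c i" "sum c I = 1" "(\<Sum>i\<in>I. c i *\<^sub>R t i) = p"
    using assms(1,5) convex_hull_image_iff[of I p t] by auto
  show thesis
  proof (cases "\<exists>m\<in>I. c m = 0")
    case True
    then obtain m where "m \<in> I" "c m = 0" by blast
    then show thesis
      using that convex_hull_drop_zeros[OF assms(1) c, of "{m}"] by simp
  next
    case False
    then have pos: "\<And>i. i \<in> I \<Longrightarrow> 0 < c i"
      using c(1) by (metis less_eq_real_def)
    have hyp: "w \<bullet> t i = w \<bullet> p" if "i \<in> I" for i
      by (rule positive_weights_in_hyperplane[OF assms(1) pos c(2,3) assms(4) that])
    obtain v where v: "(\<Sum>i\<in>I. v i *\<^sub>R t i) = 0" "sum v I = 0" "\<exists>i\<in>I. v i < 0"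
      using hyperplane_affine_relation[where t = t and b = "w \<bullet> p", OF assms(1-3) hyp] by blast
    obtain i where i: "i \<in> I" "v i < 0" "\<And>l. l \<in> I \<Longrightarrow> v l < 0 \<Longrightarrow> c i / - v i \<le> c l / - v l"
      using exists_min_ratio[OF assms(1) v(3), of c] by blast
    show thesis
      using i(2) by (intro that[OF i(1)] ratio_pivot[OF assms(1) c v(1,2) i]) auto
  qed
qed

text \<open>
  Sweep the segment from weights \<open>c\<close> vanishing at \<open>j\<close> to weights \<open>d\<close> vanishing at \<open>k\<close>, pushing every
  point along one fixed affine relation \<open>v\<close> until a coordinate vanishes. The closed sets \<open>S i\<close> of
  parameters at which coordinate \<open>i\<close> vanishes cover the connected interval [0, 1]. The choices
  \<open>v j = 0\<close> and \<open>v k \<le> 0\<close> keep \<open>j\<close> and \<open>k\<close> vanishing at the two ends.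
\<close>
lemma facets_connected:
  fixes t :: "'i \<Rightarrow> 'a::euclidean_space"
  assumes fin: "finite I" and card: "card I \<ge> DIM('a) + 2" and w: "w \<noteq> 0"
    and supp: "\<And>i. i \<in> I \<Longrightarrow> w \<bullet> p \<le> w \<bullet> t i"
    and j: "j \<in> I" "p \<in> convex hull (t ` (I - {j}))"
    and k: "k \<in> I" "p \<in> convex hull (t ` (I - {k}))"
  shows "(\<lambda>l m. l \<in> I \<and> m \<in> I \<and> p \<in> convex hull (t ` (I - {l, m})))\<^sup>*\<^sup>* j k"
    (is "?R\<^sup>*\<^sup>* j k")
proof -
  obtain c where c: "\<And>i. i \<in> I \<Longrightarrow> 0 \<le> c i" "sum c I = 1" "(\<Sum>i\<in>I. c i *\<^sub>R t i) = p" "c j = 0"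
    using convex_hull_remove_weights[OF fin j(2)] j(1) by auto
  obtain d where d: "\<And>i. i \<in> I \<Longrightarrow> 0 \<le> d i" "sum d I = 1" "(\<Sum>i\<in>I. d i *\<^sub>R t i) = p" "d k = 0"
    using convex_hull_remove_weights[OF fin k(2)] k(1) by auto
  show ?thesis
  proof (cases "\<exists>m\<in>I. c m = 0 \<and> d m = 0")
    case True
    then obtain m where m: "m \<in> I" "c m = 0" "d m = 0" by blast
    have "p \<in> convex hull (t ` (I - {j, m}))"
      by (rule convex_hull_drop_zeros[OF fin c(1-3)]) (use m c(4) in auto)
    moreover have "p \<in> convex hull (t ` (I - {m, k}))"
      by (rule convex_hull_drop_zeros[OF fin d(1-3)]) (use m d(4) in auto)
    ultimately have "?R j m" "?R m k" using m(1) j(1) k(1) by blast+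
    then show ?thesis by (rule converse_rtranclp_into_rtranclp[OF _ r_into_rtranclp])
  next
    case False
    define e where "e s = (\<lambda>i. (1 - s) * c i + s * d i)" for s :: real
    have e: "\<And>i. i \<in> I \<Longrightarrow> 0 \<le> e s i" "sum (e s) I = 1" "(\<Sum>i\<in>I. e s i *\<^sub>R t i) = p"
      if "s \<in> {0..1}" for s
    proof -
      show "0 \<le> e s i" if "i \<in> I" for i
        using \<open>s \<in> {0..1}\<close> c(1)[OF that] d(1)[OF that] by (simp add: e_def)
      show "sum (e s) I = 1"
        unfolding e_def sum.distrib sum_distrib_left[symmetric] using c(2) d(2) by simp
      show "(\<Sum>i\<in>I. e s i *\<^sub>R t i) = p"
        unfolding e_def scaleR_add_left sum.distrib scaleR_scaleR[symmetric] scaleR_sum_right[symmetric]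
        using c(3) d(3) by (simp flip: scaleR_add_left)
    qed
    \<comment> \<open>No coordinate vanishes at both ends, so at the midpoint all weights are
      positive; this puts every point in the hyperplane.\<close>
    have pos: "0 < e (1/2) i" if "i \<in> I" for i
    proof -
      have "c i \<noteq> 0 \<or> d i \<noteq> 0" using False that by blast
      with c(1)[OF that] d(1)[OF that] show ?thesis
        by (auto simp: e_def less_eq_real_def add_pos_pos)
    qed
    have hyp: "w \<bullet> t i = w \<bullet> p" if "i \<in> I" for i
      by (rule positive_weights_in_hyperplane[OF fin pos e(2,3) supp that]) auto
    \<comment> \<open>The second extra index pays for leaving out \<open>j\<close>, which gives a
      relation with \<open>v j = 0\<close>.\<close>
    have "card (I - {j}) > DIM('a)" using fin j(1) card by simp
    then obtain v0 where v0: "(\<Sum>i\<in>I - {j}. v0 i *\<^sub>R t i) = 0" "sum v0 (I - {j}) = 0"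
      "\<exists>i\<in>I - {j}. v0 i < 0"
      using hyperplane_affine_relation[of "I - {j}" w t "w \<bullet> p"] fin w hyp by auto
    \<comment> \<open>Coefficients of both signs keep a negative one available after the sign change
      that makes \<open>v k \<le> 0\<close>.\<close>
    have v0': "\<exists>i\<in>I - {j}. v0 i > 0"
    proof (rule ccontr)
      assume "\<not> ?thesis"
      then have "sum v0 (I - {j}) < 0"
        using v0(3) fin by (intro order.strict_trans2[OF sum_strict_mono_ex1[where g = "\<lambda>_. 0"]]) (auto simp: not_less)
      with v0(2) show False by simp
    qed
    define v where "v = (\<lambda>i. if i = j then 0 else if v0 k \<le> 0 then v0 i else - v0 i)"
    have vj: "v j = 0" and vk: "v k \<le> 0" by (auto simp: v_def)
    have "(\<Sum>i\<in>I. v i *\<^sub>R t i) = (\<Sum>i\<in>I - {j}. v i *\<^sub>R t i)" "sum v I = sum v (I - {j})"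
      using sum.remove[OF fin j(1), of v] sum.remove[OF fin j(1), of "\<lambda>i. v i *\<^sub>R t i"] vj
      by simp_all
    moreover have "(\<Sum>i\<in>I - {j}. v i *\<^sub>R t i) = 0" "sum v (I - {j}) = 0"
      using v0(1,2) by (cases "v0 k \<le> 0"; simp add: v_def sum_negf)+
    ultimately have v: "(\<Sum>i\<in>I. v i *\<^sub>R t i) = 0" "sum v I = 0" by simp_all
    have vneg: "\<exists>i\<in>I. v i < 0" using v0(3) v0' by (auto simp: v_def)
    define S where "S i = {s\<in>{0..1}. \<forall>l\<in>I. v l < 0 \<longrightarrow> e s i / - v i \<le> e s l / - v l}" for i
    define N where "N = {i\<in>I. v i < 0}"
    have pivot: "p \<in> convex hull (t ` (I - Z))"
      if "s \<in> S i" "i \<in> N" "\<And>m. m \<in> Z \<Longrightarrow> e s m + e s i / - v i * v m = 0" for s i Z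
      using that by (intro ratio_pivot[OF fin e[of s] v, of i]) (auto simp: S_def N_def)
    have closed: "closed (S i)" for i
    proof -
      have cont: "continuous_on UNIV (\<lambda>s. e s l / b)" for l b
        unfolding e_def divide_inverse by (intro continuous_on_mult_right continuous_intros)
      have "closed {s. e s i / - v i \<le> e s l / - v l}" for l
        by (intro closed_Collect_le cont)
      moreover have "S i = {0..1} \<inter> (\<Inter>l\<in>N. {s. e s i / - v i \<le> e s l / - v l})"
        by (auto simp: S_def N_def)
      ultimately show ?thesis by (simp add: closed_Int closed_INT)
    qed
    have cover: "\<exists>i\<in>N. s \<in> S i" if "s \<in> {0..1}" for s
    proof -
      obtain i where "i \<in> I" "v i < 0" "\<And>l. l \<in> I \<Longrightarrow> v l < 0 \<Longrightarrow> e s i / - v i \<le> e s l / - v l"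
        using exists_min_ratio[OF fin vneg, of "e s"] by blast
      then show ?thesis using that by (auto simp: S_def N_def)
    qed
    \<comment> \<open>Two minimal ratios are equal, so a single pivot makes both coordinates
      vanish.\<close>
    have meet: "?R i l" if "s \<in> S i" "s \<in> S l" "i \<in> N" "l \<in> N" for s i l
    proof -
      have "e s i / - v i = e s l / - v l" "v i < 0" "v l < 0"
        using that by (auto simp: S_def N_def intro!: antisym)
      then have "p \<in> convex hull (t ` (I - {i, l}))"
        using that by (intro pivot[of s i]) (auto simp: field_simps)
      then show ?thesis using that by (simp add: N_def)
    qed
    obtain i0 where i0: "i0 \<in> N" "0 \<in> S i0" using cover[of 0] by auto
    have "p \<in> convex hull (t ` (I - {j, i0}))"
      using i0 c(4) vj by (intro pivot[of 0 i0]) (auto simp: N_def e_def)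
    then have start: "?R j i0" using i0 j by (simp add: N_def)
    obtain i1 where i1: "i1 \<in> N" "1 \<in> S i1" "?R i1 k"
    proof (cases "v k = 0")
      case True
      obtain i1 where i1: "i1 \<in> N" "1 \<in> S i1" using cover[of 1] by auto
      have "p \<in> convex hull (t ` (I - {i1, k}))"
        using i1 d(4) True by (intro pivot[of 1 i1]) (auto simp: N_def e_def)
      with i1 k(1) show thesis by (intro that[OF i1]) (simp add: N_def)
    next
      case False
      \<comment> \<open>Since \<open>d k = 0\<close>, the ratio of \<open>k\<close> at parameter 1
        is 0, the least possible; \<open>k\<close> itself serves as \<open>i1\<close>.\<close>
      then have "k \<in> N" "1 \<in> S k"
        using vk k(1) d(1,4) by (auto simp: N_def S_def e_def divide_nonneg_neg)
      then show thesis using k by (intro that) auto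
    qed
    \<comment> \<open>If \<open>i1\<close> were not reachable, the parameters of reachable and of
      unreachable pivots would split [0, 1] into two disjoint nonempty closed sets.\<close>
    let ?G = "{i\<in>N. ?R\<^sup>*\<^sup>* j i}"
    have "finite N" using fin by (simp add: N_def)
    have "?R\<^sup>*\<^sup>* j i1"
    proof (rule ccontr)
      assume no: "\<not> ?R\<^sup>*\<^sup>* j i1"
      have "closed (\<Union>i\<in>?G. S i)" "closed (\<Union>i\<in>N - ?G. S i)"
        using \<open>finite N\<close> closed by auto
      moreover have "{0..1} \<subseteq> (\<Union>i\<in>?G. S i) \<union> (\<Union>i\<in>N - ?G. S i)"
        using cover by blast
      moreover have "(\<Union>i\<in>?G. S i) \<inter> (\<Union>i\<in>N - ?G. S i) \<inter> {0..1} = {}"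
      proof -
        have False if "s \<in> S i" "s \<in> S l" "i \<in> ?G" "l \<in> N - ?G" for s i l
          using that meet[of s i l] rtranclp.rtrancl_into_rtrancl[of ?R j i l] by blast
        then show ?thesis by blast
      qed
      moreover have "0 \<in> (\<Union>i\<in>?G. S i) \<inter> {0..1}"
        using i0 start by (auto intro: r_into_rtranclp)
      moreover have "1 \<in> (\<Union>i\<in>N - ?G. S i) \<inter> {0..1}"
        using i1 no by auto
      ultimately show False
        using connected_closedD[OF connected_Icc, of "\<Union>i\<in>?G. S i" "\<Union>i\<in>N - ?G. S i" 0 "1::real"]
        by (metis (no_types, lifting) empty_iff)
    qed
    then show ?thesis using i1(3) by (rule rtranclp.rtrancl_into_rtrancl)
  qed
qed

section \<open>Nearest points and supporting hyperplanes\<close>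

text \<open>The hull misses the open ball, so \<open>p\<close> is a point of it nearest to
  \<open>x\<close>, and the obtuse angle criterion applies.\<close>

lemma closest_point_supports:
  fixes x :: "'a::euclidean_space"
  assumes "finite S" "p \<in> convex hull S" "dist x p \<le> r" "convex hull S \<inter> ball x r = {}"
    and y: "y \<in> convex hull S"
  shows "(p - x) \<bullet> p \<le> (p - x) \<bullet> y"
proof -
  have "\<forall>z\<in>convex hull S. dist x p \<le> dist x z"
    using assms(3,4) by (fastforce simp: disjoint_iff)
  then have "(x - p) \<bullet> (y - p) \<le> 0"
    using assms by (intro any_closest_point_dot[of "convex hull S"])
      (auto intro: compact_imp_closed finite_imp_compact_convex_hull)
  then show ?thesis by (simp add: algebra_simps)
qed

lemma closer_point_in_insert:
  fixes x :: "'a::euclidean_space"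
  assumes "p \<in> convex hull S" "dist x p \<le> r" "(p - x) \<bullet> c < (p - x) \<bullet> p" "insert c S \<subseteq> S'"
  shows "convex hull S' \<inter> ball x r \<noteq> {}"
proof -
  have "(x - p) \<bullet> (c - p) > 0" using assms(3) by (simp add: algebra_simps)
  then obtain u where u: "0 < u" "u \<le> 1" "dist (p + u *\<^sub>R (c - p)) x < dist p x"
    using closer_point_lemma[of x p c] by blast
  have "p \<in> convex hull S'" "c \<in> convex hull S'"
    using assms(1,4) hull_mono[of S S'] by (auto intro: hull_inc)
  then have "(1 - u) *\<^sub>R p + u *\<^sub>R c \<in> convex hull S'"
    using u by (intro convexD) auto
  moreover have "(1 - u) *\<^sub>R p + u *\<^sub>R c = p + u *\<^sub>R (c - p)" by (simp add: algebra_simps)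
  ultimately show ?thesis using u(3) assms(2) by (auto simp: dist_commute)
qed

text \<open>The half-space beyond \<open>p\<close> is convex, and by Cauchy-Schwarz none of its
  points is nearer to \<open>x\<close> than \<open>p\<close>.\<close>

lemma supported_imp_far:
  fixes x :: "'a::euclidean_space"
  assumes "\<And>y. y \<in> S \<Longrightarrow> (p - x) \<bullet> p \<le> (p - x) \<bullet> y" "r \<le> dist x p"
  shows "convex hull S \<inter> ball x r = {}"
proof -
  have "convex hull S \<subseteq> {y. (p - x) \<bullet> y \<ge> (p - x) \<bullet> p}"
    using assms(1) by (intro hull_minimal convex_halfspace_ge) auto
  moreover have "dist x p \<le> dist x y" if "(p - x) \<bullet> y \<ge> (p - x) \<bullet> p" for y
  proof (cases "p = x")
    case False
    have "norm (p - x) * norm (p - x) = (p - x) \<bullet> (p - x)"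
      by (simp add: dot_square_norm power2_eq_square)
    also have "\<dots> \<le> (p - x) \<bullet> (y - x)"
      using that by (simp add: inner_diff_right)
    also have "\<dots> \<le> norm (p - x) * norm (y - x)"
      by (rule norm_cauchy_schwarz)
    finally show ?thesis using False by (simp add: dist_norm norm_minus_commute)
  qed simp
  ultimately show ?thesis using assms(2) by fastforce
qed

text \<open>Otherwise the half-space beyond \<open>p\<close> would contain the hull and hence
  \<open>x\<close>. This supplies an improving point in every colour class.\<close>

lemma hull_point_below:
  fixes x :: "'a::real_inner"
  assumes "x \<in> convex hull S" "p \<noteq> x"
  obtains c where "c \<in> S" "(p - x) \<bullet> c < (p - x) \<bullet> p"
proof -
  have "\<not> S \<subseteq> {y. (p - x) \<bullet> y \<ge> (p - x) \<bullet> p}"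
  proof
    assume "S \<subseteq> {y. (p - x) \<bullet> y \<ge> (p - x) \<bullet> p}"
    then have "convex hull S \<subseteq> {y. (p - x) \<bullet> y \<ge> (p - x) \<bullet> p}"
      by (intro hull_minimal convex_halfspace_ge)
    with assms(1) have "(p - x) \<bullet> (p - x) \<le> 0" by (auto simp: inner_diff_right)
    with assms(2) show False by (metis inner_gt_zero_iff not_le right_minus_eq)
  qed
  then obtain c where "c \<in> S" "\<not> (p - x) \<bullet> c \<ge> (p - x) \<bullet> p" by blast
  then show thesis using that by simp
qed

section \<open>Colourful tuples and moves between them\<close>

locale colour_classes =
  fixes A :: "nat \<Rightarrow> 'a::euclidean_space set" and x :: 'a and n :: nat
  assumes finite_class: "i < n \<Longrightarrow> finite (A i)"
    and centre_in_class: "i < n \<Longrightarrow> x \<in> convex hull (A i)"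
    and many_classes: "n \<ge> DIM('a) + 2"
begin

abbreviation "tuples \<equiv> \<Pi>\<^sub>E i\<in>{..<n}. A i"

definition ridge :: "(nat \<Rightarrow> 'a) \<Rightarrow> nat \<Rightarrow> 'a set" where
  "ridge t j = convex hull (t ` ({..<n} - {j}))"

text \<open>\<open>B\<close> will be a closed ball (steps of size at most \<open>r\<close>), an open
  ball (steps below \<open>r\<close>) or \<open>{x}\<close>. The tuples need not be vertices of the
  graph, and \<open>t = t'\<close> is allowed.\<close>

definition move :: "'a set \<Rightarrow> (nat \<Rightarrow> 'a) \<Rightarrow> (nat \<Rightarrow> 'a) \<Rightarrow> bool" where
  "move B t t' \<longleftrightarrow> t \<in> tuples \<and> t' \<in> tuples \<and>
     (\<exists>j<n. (\<forall>i. i \<noteq> j \<longrightarrow> t i = t' i) \<and> ridge t j \<inter> B \<noteq> {})"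

lemma ridge_cong: "(\<And>i. i \<noteq> j \<Longrightarrow> t i = t' i) \<Longrightarrow> ridge t j = ridge t' j"
  unfolding ridge_def by (intro arg_cong[where f = "\<lambda>S. convex hull S"] image_cong) auto

lemma move_sym: "move B t t' \<Longrightarrow> move B t' t"
  unfolding move_def by (metis ridge_cong)

lemma move_mono: "move B t t' \<Longrightarrow> B \<subseteq> C \<Longrightarrow> move C t t'"
  unfolding move_def by blast

lemma move_rtranclp_tuples: "(move B)\<^sup>*\<^sup>* t t' \<Longrightarrow> t \<in> tuples \<Longrightarrow> t' \<in> tuples"
  by (induction rule: rtranclp_induct) (auto simp: move_def)

lemma tuples_update: "t \<in> tuples \<Longrightarrow> j < n \<Longrightarrow> u \<in> A j \<Longrightarrow> t(j := u) \<in> tuples"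
  by (auto simp: PiE_iff extensional_def)

section \<open>Rerouting around a critical tuple\<close>

text \<open>The unchanged points include \<open>u\<close> together with points whose hull contains
  \<open>p\<close>, so moving from \<open>p\<close> towards \<open>u\<close> comes closer to
  \<open>x\<close>. The new point \<open>v\<close> may be any of its colour.\<close>

lemma move_second:
  assumes "t \<in> tuples" "j < n" "u \<in> A j" "m < n" "v \<in> A m" "j \<noteq> m"
    and "p \<in> convex hull (t ` ({..<n} - {j, m}))" "dist x p \<le> r" "(p - x) \<bullet> u < (p - x) \<bullet> p"
  shows "move (ball x r) (t(j := u)) (t(j := u, m := v))"
proof -
  have "ridge (t(j := u)) m \<inter> ball x r \<noteq> {}"
    unfolding ridge_def
    by (rule closer_point_in_insert[OF assms(7-9)]) (use assms(2,6) in auto)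
  then show ?thesis
    using assms tuples_update unfolding move_def by (auto intro!: exI[of _ m])
qed

lemma reroute_same:
  assumes "t \<in> tuples" "j < n" "p \<in> ridge t j" "dist x p \<le> r" "p \<noteq> x"
    and supp: "\<And>i. i < n \<Longrightarrow> i \<noteq> j \<Longrightarrow> (p - x) \<bullet> p \<le> (p - x) \<bullet> t i"
    and u: "u \<in> A j" "(p - x) \<bullet> u < (p - x) \<bullet> p"
    and v: "v \<in> A j" "(p - x) \<bullet> v < (p - x) \<bullet> p"
  shows "(move (ball x r))\<^sup>*\<^sup>* (t(j := u)) (t(j := v))"
proof -
  have "card ({..<n} - {j}) > DIM('a)" using many_classes assms(2) by simp
  then obtain m where m: "m \<in> {..<n} - {j}" "p \<in> convex hull (t ` ({..<n} - {j} - {m}))"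
    using supported_caratheodory[of "{..<n} - {j}" "p - x" p t] assms(3,5) supp
    by (auto simp: ridge_def)
  have jm: "p \<in> convex hull (t ` ({..<n} - {j, m}))" "p \<in> convex hull (t ` ({..<n} - {m, j}))"
    using m(2) by (simp_all add: Diff_insert2[symmetric] insert_commute)
  obtain c where c: "c \<in> A m" "(p - x) \<bullet> c < (p - x) \<bullet> p"
    using hull_point_below[OF centre_in_class assms(5)] m(1) by auto
  have "move (ball x r) (t(j := u)) (t(j := u, m := c))"
    using assms m(1) jm c by (intro move_second) auto
  moreover have "move (ball x r) (t(j := u, m := c)) (t(j := v, m := c))"
  proof -
    have "t(j := u) ` ({..<n} - {m, j}) = t ` ({..<n} - {m, j})" by (auto simp: image_def)
    then have "move (ball x r) (t(j := u, m := c)) (t(j := u, m := c, j := v))"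
      using assms m(1) jm c tuples_update by (intro move_second) auto
    then show ?thesis using m(1) by (simp add: fun_upd_twist)
  qed
  moreover have "move (ball x r) (t(j := v, m := c)) (t(j := v))"
    using assms m(1) jm c by (intro move_sym[OF move_second]) auto
  ultimately show ?thesis
    by (blast intro: converse_rtranclp_into_rtranclp)
qed

text \<open>Follows a chain of dispensable coordinates from \<open>j\<close> to \<open>k\<close>.
  For a link between distinct \<open>l\<close> and \<open>m\<close>, the tuples improved at one of
  them are joined through the tuple improved at both.\<close>

lemma reroute:
  assumes t: "t \<in> tuples" and p: "dist x p \<le> r" "p \<noteq> x"
    and supp: "\<And>i. i < n \<Longrightarrow> (p - x) \<bullet> p \<le> (p - x) \<bullet> t i"
    and j: "j < n" "p \<in> ridge t j" "u \<in> A j" "(p - x) \<bullet> u < (p - x) \<bullet> p"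
    and k: "k < n" "p \<in> ridge t k" "v \<in> A k" "(p - x) \<bullet> v < (p - x) \<bullet> p"
  shows "(move (ball x r))\<^sup>*\<^sup>* (t(j := u)) (t(k := v))"
proof -
  let ?R = "\<lambda>l m. l \<in> {..<n} \<and> m \<in> {..<n} \<and> p \<in> convex hull (t ` ({..<n} - {l, m}))"
  have "?R\<^sup>*\<^sup>* j k"
    using many_classes p supp j k by (intro facets_connected[where w = "p - x"]) (auto simp: ridge_def)
  then show ?thesis using k
  proof (induction arbitrary: v rule: rtranclp_induct)
    case base
    then show ?case using assms by (intro reroute_same[where p = p]) auto
  next
    case (step l m)
    obtain c where c: "c \<in> A l" "(p - x) \<bullet> c < (p - x) \<bullet> p"
      using hull_point_below[OF centre_in_class p(2)] step.hyps(2) by auto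
    have l: "l < n" "p \<in> convex hull (t ` ({..<n} - {l, m}))" "p \<in> convex hull (t ` ({..<n} - {m, l}))"
      using step.hyps(2) by (auto simp: insert_commute)
    then have "p \<in> ridge t l"
      unfolding ridge_def using hull_mono[of "t ` ({..<n} - {l, m})" "t ` ({..<n} - {l})" convex] by auto
    note IH = step.IH[OF l(1) this c]
    have "(move (ball x r))\<^sup>*\<^sup>* (t(l := c)) (t(m := v))"
    \<comment> \<open>A link may be a loop; then only the improving point at \<open>l\<close> has to
      be exchanged.\<close>
    proof (cases "l = m")
      case True
      then show ?thesis
        using reroute_same[OF t step.prems(1,2) p supp _ _ step.prems(3,4), of c] c by simp
    next
      case False
      have "move (ball x r) (t(l := c)) (t(l := c, m := v))"
        using False t c step.prems p l by (intro move_second) auto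
      moreover have "move (ball x r) (t(m := v)) (t(m := v, l := c))"
        using False t c step.prems p l by (intro move_second) auto
      ultimately show ?thesis
        using False by (metis (no_types, lifting) fun_upd_twist move_sym rtranclp.simps)
    qed
    with IH show ?case by (rule rtranclp_trans)
  qed
qed

section \<open>Lowering a walk below its largest step\<close>

lemma ridge_subset: "j < n \<Longrightarrow> ridge t j \<subseteq> convex hull (t ` {..<n})"
  unfolding ridge_def by (intro hull_mono) auto

text \<open>
  Induction along the walk: a tuple at distance exactly \<open>r\<close> need not be reachable by shorter steps
  itself, but each of its improvements at a dispensable coordinate is.
\<close>
lemma lower_path:
  assumes r: "r > 0" and ab: "(move (cball x r))\<^sup>*\<^sup>* a b" and a: "a \<in> tuples"
    and "convex hull (a ` {..<n}) \<inter> ball x r \<noteq> {}" "convex hull (b ` {..<n}) \<inter> ball x r \<noteq> {}"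
  shows "(move (ball x r))\<^sup>*\<^sup>* a b"
proof -
  let ?low = "\<lambda>t. convex hull (t ` {..<n}) \<inter> ball x r \<noteq> {}"
  let ?L = "(move (ball x r))\<^sup>*\<^sup>* a"
  let ?Q = "\<lambda>t. (?low t \<longrightarrow> ?L t) \<and>
    (\<not> ?low t \<longrightarrow> (\<forall>p j c. dist x p \<le> r \<longrightarrow> j < n \<longrightarrow> p \<in> ridge t j \<longrightarrow> c \<in> A j \<longrightarrow>
       (p - x) \<bullet> c < (p - x) \<bullet> p \<longrightarrow> ?L (t(j := c))))"
  have "?Q b" using ab
  proof (induction rule: rtranclp_induct)
    case base
    then show ?case using assms by simp
  next
    case (step t t')
    obtain j where t: "t \<in> tuples" "t' \<in> tuples" "j < n" "\<And>i. i \<noteq> j \<Longrightarrow> t i = t' i"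
      and meet: "ridge t j \<inter> cball x r \<noteq> {}"
      using step.hyps(2) unfolding move_def by blast
    have ridge_eq: "ridge t j = ridge t' j" by (rule ridge_cong[OF t(4)])
    have upd: "t(j := y) = t'(j := y)" for y using t(4) by auto
    have tn: "t i \<in> A i" "t' i \<in> A i" if "i < n" for i using t that by auto
    show ?case
    proof (cases "ridge t j \<inter> ball x r = {}")
      case False
      then have "?low t" "?low t'" using ridge_subset[of j] t(3) ridge_eq by blast+
      moreover have "move (ball x r) t t'" using False t unfolding move_def by blast
      ultimately show ?thesis using step.IH by (meson rtranclp.rtrancl_into_rtrancl)
    next
      case True
      \<comment> \<open>The ridge meets the closed ball but not the open one, so \<open>p\<close> is
        at distance exactly \<open>r\<close>.\<close>
      obtain p where p: "p \<in> ridge t' j" "dist x p \<le> r" using meet ridge_eq by auto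
      then have "\<not> dist x p < r" using True ridge_eq by auto
      with r have px: "p \<noteq> x" by auto
      have far: "r \<le> dist x p" using \<open>\<not> dist x p < r\<close> by simp
      have supp: "(p - x) \<bullet> p \<le> (p - x) \<bullet> t' i" if "i < n" "i \<noteq> j" for i
        by (rule closest_point_supports[of "t' ` ({..<n} - {j})" p x r])
          (use p True ridge_eq that in \<open>auto simp: ridge_def intro: hull_inc\<close>)
      \<comment> \<open>All other points of \<open>s\<close> lie beyond the hyperplane at
        \<open>p\<close>, so only the one at \<open>j\<close> can bring the hull into the open
        ball.\<close>
      have below: "(p - x) \<bullet> s j < (p - x) \<bullet> p" if "?low s" "\<And>i. i \<noteq> j \<Longrightarrow> s i = t' i" for s
      proof (rule ccontr)
        assume "\<not> ?thesis"
        then have "convex hull (s ` {..<n}) \<inter> ball x r = {}"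
          using supp that(2) by (intro supported_imp_far[OF _ far]) (force simp: not_less)
        with that(1) show False by simp
      qed
      \<comment> \<open>Updating \<open>t\<close> or \<open>t'\<close> at \<open>j\<close> gives the
        same tuple, so a reachable improvement of \<open>t'\<close> is \<open>t\<close> itself when
        \<open>t\<close> is low, and otherwise comes from the induction hypothesis.\<close>
      obtain c where c: "c \<in> A j" "(p - x) \<bullet> c < (p - x) \<bullet> p" "?L (t'(j := c))"
      proof (cases "?low t")
        case True
        have "t'(j := t j) = t" using t(4) by auto
        then show thesis
          using that[of "t j"] below[OF True t(4)] True step.IH tn t(3) by simp
      next
        case False
        obtain c where c: "c \<in> A j" "(p - x) \<bullet> c < (p - x) \<bullet> p"
          using hull_point_below[OF centre_in_class px] t(3) by metis
        then have "?L (t(j := c))"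
          using False step.IH p t(3) ridge_eq by blast
        with c show thesis using that upd by simp
      qed
      show ?thesis
      proof (intro conjI impI allI)
        assume "?low t'"
        then have "(move (ball x r))\<^sup>*\<^sup>* (t'(j := c)) (t'(j := t' j))"
          using c t p px supp tn below[of t'] by (intro reroute_same[where p = p]) auto
        then show "?L t'" using c(3) by (simp add: rtranclp_trans)
      next
        fix q k d
        assume low: "\<not> ?low t'" and q: "dist x q \<le> r" "k < n" "q \<in> ridge t' k" "d \<in> A k"
          "(q - x) \<bullet> d < (q - x) \<bullet> q"
        have ph: "p \<in> convex hull (t' ` {..<n})" and qh: "q \<in> convex hull (t' ` {..<n})"
          using p q t(3) ridge_subset by blast+
        have min: "\<forall>z\<in>convex hull (t' ` {..<n}). dist x y \<le> dist x z" if "dist x y \<le> r" for y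
          using low that by (fastforce simp: disjoint_iff)
        \<comment> \<open>Both are nearest to \<open>x\<close> in the full hull of
          \<open>t'\<close>, and the nearest point of a closed convex set is unique. Hence one
          hyperplane supports both improvements.\<close>
        have "q = p"
          by (rule any_closest_point_unique[OF _ _ qh ph min[OF q(1)] min[OF p(2)]])
            (auto intro: compact_imp_closed finite_imp_compact_convex_hull)
        moreover have "(p - x) \<bullet> p \<le> (p - x) \<bullet> t' i" if "i < n" for i
          by (rule closest_point_supports[of "t' ` {..<n}" p x r])
            (use ph p(2) low that in \<open>auto intro: hull_inc\<close>)
        ultimately have "(move (ball x r))\<^sup>*\<^sup>* (t'(j := c)) (t'(k := d))"
          using c t p px q by (intro reroute[where p = p]) auto
        with c(3) show "?L (t'(k := d))" by (rule rtranclp_trans)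
      qed
    qed
  qed
  then show ?thesis using assms by blast
qed

section \<open>Minimising the largest step\<close>

lemma finite_tuples: "finite tuples"
  using finite_class by (intro finite_PiE) auto

lemma ridge_attains_infdist:
  assumes "j < n"
  obtains y where "y \<in> ridge t j" "infdist x (ridge t j) = dist x y"
proof -
  have "card ({..<n} - {j}) > 0" using many_classes assms by simp
  then have "ridge t j \<noteq> {}" by (auto simp: ridge_def card_gt_0_iff)
  moreover have "closed (ridge t j)"
    by (auto simp: ridge_def intro: compact_imp_closed finite_imp_compact_convex_hull)
  ultimately show thesis using infdist_attains_inf that by metis
qed

text \<open>0 is adjoined so that every \<open>r > 0\<close> has a smaller value below it.\<close>
definition ridge_distances :: "real set" where
  "ridge_distances = insert 0 ((\<lambda>(t, j). infdist x (ridge t j)) ` (tuples \<times> {..<n}))"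

lemma finite_ridge_distances: "finite ridge_distances"
  using finite_tuples by (simp add: ridge_distances_def)

lemma move_cball_iff:
  "move (cball x r) t t' \<longleftrightarrow> t \<in> tuples \<and> t' \<in> tuples \<and>
     (\<exists>j<n. (\<forall>i. i \<noteq> j \<longrightarrow> t i = t' i) \<and> infdist x (ridge t j) \<le> r)"
proof -
  have "ridge t j \<inter> cball x r \<noteq> {} \<longleftrightarrow> infdist x (ridge t j) \<le> r" if "j < n" for j
  proof -
    obtain y where y: "y \<in> ridge t j" "infdist x (ridge t j) = dist x y"
      using ridge_attains_infdist[OF \<open>j < n\<close>] by metis
    have "infdist x (ridge t j) \<le> r" if "z \<in> ridge t j \<inter> cball x r" for z
      using that infdist_le[of z "ridge t j" x] by simp
    moreover have "y \<in> ridge t j \<inter> cball x r" if "infdist x (ridge t j) \<le> r"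
      using that y by simp
    ultimately show ?thesis by blast
  qed
  then show ?thesis unfolding move_def by (metis (no_types, lifting))
qed

text \<open>Only finitely many ridge distances occur, so a strict bound \<open>r\<close> improves to
  the next smaller value.\<close>

lemma move_ball_lower:
  assumes "move (ball x r) t t'" "0 < r"
  shows "move (cball x (Max {d\<in>ridge_distances. d < r})) t t'"
proof -
  obtain j where t: "t \<in> tuples" "t' \<in> tuples" "j < n" "\<forall>i. i \<noteq> j \<longrightarrow> t i = t' i"
    and "ridge t j \<inter> ball x r \<noteq> {}"
    using assms(1) unfolding move_def by blast
  then have "infdist x (ridge t j) < r" by (auto intro: le_less_trans[OF infdist_le])
  then have "infdist x (ridge t j) \<le> Max {d\<in>ridge_distances. d < r}"
    using t finite_ridge_distances by (intro Max_ge) (auto simp: ridge_distances_def)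
  then show ?thesis using t by (auto simp: move_cball_iff)
qed

lemma coarse_path:
  assumes a: "a \<in> tuples" and b: "b \<in> tuples"
  shows "(move (cball x (Max ridge_distances)))\<^sup>*\<^sup>* a b"
proof -
  \<comment> \<open>Hybrid tuples that replace \<open>a\<close> by \<open>b\<close> one coordinate
    at a time.\<close>
  let ?c = "\<lambda>m i. if i < m then b i else a i"
  have "(move (cball x (Max ridge_distances)))\<^sup>*\<^sup>* a (?c m)" if "m \<le> n" for m
    using that
  proof (induction m)
    case (Suc m)
    have c: "?c m \<in> tuples" "?c (Suc m) \<in> tuples"
      using a b Suc.prems by (auto simp: PiE_iff extensional_def)
    have "infdist x (ridge (?c m) m) \<in> ridge_distances"
      using c Suc.prems unfolding ridge_distances_def by (intro insertI2 image_eqI[of _ _ "(?c m, m)"]) auto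
    then have "infdist x (ridge (?c m) m) \<le> Max ridge_distances"
      using finite_ridge_distances by (rule Max_ge[rotated])
    then have "move (cball x (Max ridge_distances)) (?c m) (?c (Suc m))"
      unfolding move_cball_iff using c Suc.prems by (intro conjI exI[of _ m]) (simp_all add: less_Suc_eq)
    with Suc.IH[OF Suc_leD[OF Suc.prems]] show ?case
      by (rule rtranclp.rtrancl_into_rtrancl[of "move (cball x (Max ridge_distances))" a "?c m" "?c (Suc m)"])
  qed simp
  from this[of n] have "(move (cball x (Max ridge_distances)))\<^sup>*\<^sup>* a (?c n)" by simp
  moreover have "?c n = b" using a b by (auto simp: PiE_iff extensional_def)
  ultimately show ?thesis by simp
qed

text \<open>A least positive bound could be lowered, because the hulls of \<open>a\<close> and
  \<open>b\<close> contain \<open>x\<close> and so meet every open ball around it.\<close>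

lemma path_through_centre:
  assumes a: "a \<in> tuples" "x \<in> convex hull (a ` {..<n})"
    and b: "b \<in> tuples" "x \<in> convex hull (b ` {..<n})"
  shows "(move {x})\<^sup>*\<^sup>* a b"
proof -
  let ?P = "\<lambda>r. (move (cball x r))\<^sup>*\<^sup>* a b"
  let ?D = "{r\<in>ridge_distances. ?P r}"
  have "Max ridge_distances \<in> ridge_distances"
    using finite_ridge_distances by (rule Max_in) (simp add: ridge_distances_def)
  then have "Max ridge_distances \<in> ?D"
    using coarse_path[OF a(1) b(1)] by simp
  moreover have finD: "finite ?D" using finite_ridge_distances by simp
  ultimately have "Min ?D \<in> ?D" by (intro Min_in) auto
  then obtain r where r: "r \<in> ridge_distances" "?P r" "r = Min ?D" by blast
  have "\<not> 0 < r"
  proof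
    assume "0 < r"
    let ?s = "Max {d\<in>ridge_distances. d < r}"
    have "?s \<in> {d\<in>ridge_distances. d < r}"
      using \<open>0 < r\<close> finite_ridge_distances by (intro Max_in) (auto simp: ridge_distances_def)
    then have s: "?s \<in> ridge_distances" "?s < r" by auto
    have "(move (ball x r))\<^sup>*\<^sup>* a b"
      using a b \<open>0 < r\<close> r(2) by (intro lower_path) auto
    then have "?P ?s"
      using move_ball_lower \<open>0 < r\<close> by (elim mono_rtranclp[rule_format, rotated]) auto
    with s finD have "r \<le> ?s" unfolding r(3) by (intro Min_le) auto
    with s(2) show False by simp
  qed
  then have "y = x" if "y \<in> cball x r" for y
    using that zero_le_dist[of x y] by (metis dist_le_zero_iff mem_cball not_less order_trans)
  then have "cball x r \<subseteq> {x}" by blast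
  then show ?thesis
    using r(2) move_mono by (elim mono_rtranclp[rule_format, rotated]) auto
qed

section \<open>Back to the reconfiguration graph\<close>

text \<open>The common ridge contains \<open>x\<close> and lies in the hulls of both tuples, which
  makes both of them vertices.\<close>

lemma move_centre_imp_adj:
  assumes "move {x} t t'" "t \<noteq> t'"
  shows "rg_cc_adj n A x t t'"
proof -
  obtain j where t: "t \<in> tuples" "t' \<in> tuples" "j < n" "\<And>i. i \<noteq> j \<Longrightarrow> t i = t' i" "x \<in> ridge t j"
    using assms(1) unfolding move_def by blast
  have "t j \<noteq> t' j" using assms(2) t(4) by (metis ext)
  moreover have "x \<in> ridge t' j" using t(5) ridge_cong[OF t(4)] by simp
  moreover have "i = j" if "t i \<noteq> t' i" for i using t(4) that by blast
  ultimately have "\<exists>!i. i < n \<and> t i \<noteq> t' i"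
    and "\<forall>i<n. t i \<noteq> t' i \<longrightarrow> x \<in> convex hull (t ` ({..<n} - {i}))"
    and "x \<in> convex hull (t ` {..<n})" "x \<in> convex hull (t' ` {..<n})"
    using t(3,5) ridge_subset[OF t(3)] unfolding ridge_def by blast+
  then show ?thesis
    using t(1,2) by (simp add: rg_cc_adj_def rg_cc_vertices_def)
qed

lemma connected: "rg_cc_connected n A x"
  unfolding rg_cc_connected_def
proof (intro ballI)
  fix a b assume "a \<in> rg_cc_vertices n A x" "b \<in> rg_cc_vertices n A x"
  then have "(move {x})\<^sup>*\<^sup>* a b"
    by (intro path_through_centre) (auto simp: rg_cc_vertices_def)
  then show "(rg_cc_adj n A x)\<^sup>*\<^sup>* a b"
  proof (induction rule: rtranclp_induct)
    case (step t t')
    then show ?case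
      \<comment> \<open>Moves that change nothing are not edges and are skipped.\<close>
      by (cases "t = t'") (auto intro: rtranclp.rtrancl_into_rtrancl move_centre_imp_adj)
  qed simp
qed

end

theorem theorem7p5:
  fixes A :: "nat \<Rightarrow> 'a::euclidean_space set" and x :: 'a and n :: nat
  assumes "\<And>i. i < n \<Longrightarrow> finite (A i)"
    and "\<And>i. i < n \<Longrightarrow> x \<in> convex hull (A i)"
    and "n \<ge> DIM('a) + 2"
  shows "rg_cc_connected n A x"
proof -
  interpret colour_classes A x n
    using assms by unfold_locales
  show ?thesis by (rule connected)
qed

end
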